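(* Let $(X,d)$ be a $T_1$ quasi-metric space having the property that forward convergence implies backward convergence. Then the following statements are equivalent: (a) $(X,d)$ is a UC space; (b) if $A$ and $B$ are two nonempty disjoint closed subsets of $X$, then $d(A,B)>0$; (c) every closed discrete subset of $(X,d)$ is uniformly discrete.
   Context: A quasi-metric on a set $X$ is a function $d:X\times X\to\mathbb{R}$ with, for all $x,y,z\in X$: $d(x,y)\ge 0$ and $d(x,x)=0$; $d(x,y)=0=d(y,x)$ implies $x=y$; and $d(x,y)\le d(x,z)+d(z,y)$ (symmetry is not required). The forward topology $\tau(d)$ is generated by the forward balls $B^{+}(x,\epsilon)=\{y\in X: d(x,y)<\epsilon\}$. All topological notions for $(X,d)$ ($T_1$, closed, discrete, etc.) refer to $\tau(d)$. A sequence $(x_n)$ is forward convergent to $x$ if $d(x,x_n)\to 0$, and backward convergent to $x$ if $d(x_n,x)\to 0$. "Forward convergence implies backward convergence" means: whenever $(x_n)$ is forward convergent to $x$, it is also backward convergent to $x$. A function $f:(X,d)\to(\mathbb{R},|\cdot|)$ is forward continuous if it is continuous for $\tau(d)$ and the usual topology of $\mathbb{R}$; it is uniformly continuous if for every $\epsilon>0$ there is $\delta>0$ such that $d(x,y)<\delta$ implies $|f(x)-f(y)|<\epsilon$. $(X,d)$ is a UC space if every forward continuous $f:(X,d)\to(\mathbb{R},|\cdot|)$ is uniformly continuous. For nonempty $A,B\subseteq X$, $d(A,B)=\inf\{d(a,b):a\in A,\ b\in B\}$. A nonempty set $A\subseteq X$ is uniformly discrete if there is $\delta>0$ such that $d(x,y)\ge\delta$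 for all $x,y\in A$ with $x\ne y$. (The empty set is regarded as trivially uniformly discrete.) A subset is discrete if its subspace topology is discrete. *)

theory Defs imports "HOL-Analysis.Analysis" begin

text \<open>As the distance is only meaningful on the carrier, all conditions are relativised to it.\<close>

locale quasi_metric_space =
  fixes X :: "'a set" and d :: "'a \<Rightarrow> 'a \<Rightarrow> real"
  assumes nonneg: "\<And>x y. \<lbrakk>x \<in> X; y \<in> X\<rbrakk> \<Longrightarrow> 0 \<le> d x y"
    and refl: "\<And>x. x \<in> X \<Longrightarrow> d x x = 0"
    and separated: "\<And>x y. \<lbrakk>x \<in> X; y \<in> X; d x y = 0; d y x = 0\<rbrakk> \<Longrightarrow> x = y"
    and triangle: "\<And>x y z. \<lbrakk>x \<in> X; y \<in> X; z \<in> X\<rbrakk> \<Longrightarrow> d x y \<le> d x z + d z y"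

definition forward_ball :: "'a set \<Rightarrow> ('a \<Rightarrow> 'a \<Rightarrow> real) \<Rightarrow> 'a \<Rightarrow> real \<Rightarrow> 'a set" where
  "forward_ball X d x \<epsilon> = {y \<in> X. d x y < \<epsilon>}"

definition forward_topology :: "'a set \<Rightarrow> ('a \<Rightarrow> 'a \<Rightarrow> real) \<Rightarrow> 'a topology" where
  "forward_topology X d = topology_generated_by {forward_ball X d x \<epsilon> | x \<epsilon>. x \<in> X \<and> 0 < \<epsilon>}"

definition forward_convergent ::
  "'a set \<Rightarrow> ('a \<Rightarrow> 'a \<Rightarrow> real) \<Rightarrow> (nat \<Rightarrow> 'a) \<Rightarrow> 'a \<Rightarrow> bool" where
  "forward_convergent X d s x \<longleftrightarrow> range s \<subseteq> X \<and> x \<in> X \<and> (\<lambda>n. d x (s n)) \<longlonglongrightarrow> 0"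

definition backward_convergent ::
  "'a set \<Rightarrow> ('a \<Rightarrow> 'a \<Rightarrow> real) \<Rightarrow> (nat \<Rightarrow> 'a) \<Rightarrow> 'a \<Rightarrow> bool" where
  "backward_convergent X d s x \<longleftrightarrow> range s \<subseteq> X \<and> x \<in> X \<and> (\<lambda>n. d (s n) x) \<longlonglongrightarrow> 0"

definition forward_imp_backward :: "'a set \<Rightarrow> ('a \<Rightarrow> 'a \<Rightarrow> real) \<Rightarrow> bool" where
  "forward_imp_backward X d \<longleftrightarrow>
     (\<forall>s x. forward_convergent X d s x \<longrightarrow> backward_convergent X d s x)"

definition forward_continuous :: "'a set \<Rightarrow> ('a \<Rightarrow> 'a \<Rightarrow> real) \<Rightarrow> ('a \<Rightarrow> real) \<Rightarrow> bool" where
  "forward_continuous X d f \<longleftrightarrow> continuous_map (forward_topology X d) euclideanreal f"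

definition quasi_uniformly_continuous ::
  "'a set \<Rightarrow> ('a \<Rightarrow> 'a \<Rightarrow> real) \<Rightarrow> ('a \<Rightarrow> real) \<Rightarrow> bool" where
  "quasi_uniformly_continuous X d f \<longleftrightarrow>
     (\<forall>\<epsilon>>0. \<exists>\<delta>>0. \<forall>x\<in>X. \<forall>y\<in>X. d x y < \<delta> \<longrightarrow> \<bar>f x - f y\<bar> < \<epsilon>)"

definition UC_space :: "'a set \<Rightarrow> ('a \<Rightarrow> 'a \<Rightarrow> real) \<Rightarrow> bool" where
  "UC_space X d \<longleftrightarrow> (\<forall>f. forward_continuous X d f \<longrightarrow> quasi_uniformly_continuous X d f)"

text \<open>Only meaningful for nonempty \<open>A\<close> and \<open>B\<close>: the real infimum of the empty set is unspecified.\<close>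

definition set_gap :: "('a \<Rightarrow> 'a \<Rightarrow> real) \<Rightarrow> 'a set \<Rightarrow> 'a set \<Rightarrow> real" where
  "set_gap d A B = Inf {d a b | a b. a \<in> A \<and> b \<in> B}"

definition uniformly_discrete :: "('a \<Rightarrow> 'a \<Rightarrow> real) \<Rightarrow> 'a set \<Rightarrow> bool" where
  "uniformly_discrete d A \<longleftrightarrow> (\<exists>\<delta>>0. \<forall>x\<in>A. \<forall>y\<in>A. x \<noteq> y \<longrightarrow> \<delta> \<le> d x y)"

definition discrete_subset :: "'a topology \<Rightarrow> 'a set \<Rightarrow> bool" where
  "discrete_subset T A \<longleftrightarrow> A \<subseteq> topspace T \<and> subtopology T A = discrete_topology A"

end

theory Submission imports Defs begin

text \<open>
  Since forward convergence implies backward convergence, \<open>\<tau>(d)\<close> is the topology of the metric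
  \<open>D(x, y) = d(x, y) + d(y, x)\<close>, so Urysohn's lemma and sequences are available. Uniformity still
  refers to \<open>d\<close>. The implication (a) to (b) is Urysohn's lemma. For (b) to (c), if a closed
  discrete set \<open>A\<close> is not uniformly discrete, one chooses pairs \<open>x\<^sub>n \<noteq> y\<^sub>n\<close> in \<open>A\<close>
  with \<open>d(x\<^sub>n, y\<^sub>n) \<rightarrow> 0\<close>, each disjoint from the previous ones; all subsets of \<open>A\<close> are
  closed, so \<open>{x\<^sub>n}\<close> and \<open>{y\<^sub>n}\<close> contradict (b). For (c) to (a), condition (c) forces
  \<open>(a\<^sub>n)\<close> to have a convergent subsequence whenever \<open>a\<^sub>n \<noteq> b\<^sub>n\<close> and
  \<open>d(a\<^sub>n, b\<^sub>n) \<rightarrow> 0\<close>; along it \<open>b\<^sub>n\<close> has the same limit, so a continuous \<open>f\<close> cannot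
  keep \<open>f(a\<^sub>n)\<close> and \<open>f(b\<^sub>n)\<close> apart.
\<close>

section \<open>The symmetrized metric and accumulation points of sequences\<close>

text \<open>The absolute values only make the function nonnegative outside the carrier, as
  \<^locale>\<open>Metric_space\<close> demands.\<close>

definition symmetrization :: "('a \<Rightarrow> 'a \<Rightarrow> real) \<Rightarrow> 'a \<Rightarrow> 'a \<Rightarrow> real" where
  "symmetrization d x y = \<bar>d x y\<bar> + \<bar>d y x\<bar>"

lemma (in quasi_metric_space) Metric_space_symmetrization: "Metric_space X (symmetrization d)"
proof
  fix x y z assume "x \<in> X" "y \<in> X" "z \<in> X"
  then show "symmetrization d x z \<le> symmetrization d x y + symmetrization d y z"
    using triangle[of x z y] triangle[of z x y]
    by (simp add: symmetrization_def nonneg)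
qed (auto simp: symmetrization_def refl intro: separated)

text \<open>Each ball around an accumulation point contains infinitely many values of
  \<open>s\<close>, while the indices up to \<open>k\<close> contribute only finitely many. So an
  index beyond \<open>k\<close> is always available.\<close>

lemma (in Metric_space) derived_set_of_range_subsequence:
  assumes "range s \<subseteq> M" and "z \<in> mtopology derived_set_of (range s)"
  obtains r :: "nat \<Rightarrow> nat" where "strict_mono r" "limitin mtopology (s \<circ> r) z sequentially"
proof -
  have z: "z \<in> M" and inf: "\<And>e. e > 0 \<Longrightarrow> infinite (range s \<inter> mball z e)"
    using assms(2) by (auto simp: derived_set_of_infinite_mball)
  have step: "\<exists>m>k. s m \<in> mball z e" if "e > 0" for k e
  proof (rule ccontr)
    assume "\<not> ?thesis"
    then have "range s \<inter> mball z e \<subseteq> s ` {..k}"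
      by (force simp: not_less)
    then show False
      using inf[OF that] finite_subset by blast
  qed
  have "\<exists>r. \<forall>n. s (r n) \<in> mball z (inverse (Suc n)) \<and> r n < r (Suc n)"
  proof (rule dependent_nat_choice)
    show "\<exists>m. s m \<in> mball z (inverse (Suc 0))"
      using step[of "inverse (Suc 0)"] by auto
    show "\<exists>m. s m \<in> mball z (inverse (Suc (Suc n))) \<and> k < m" for k n
      using step[of "inverse (Suc (Suc n))" k] by auto
  qed
  then obtain r where r: "\<And>n. s (r n) \<in> mball z (inverse (Suc n))" "\<And>n. r n < r (Suc n)"
    by blast
  have "(\<lambda>n. d (s (r n)) z) \<longlonglongrightarrow> 0"
    using r(1)
    by (intro tendsto_sandwich[OF _ _ tendsto_const LIMSEQ_inverse_real_of_nat])
       (auto intro!: always_eventually less_imp_le simp: commute)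
  then show thesis
    using that[of r] r z by (auto simp: limitin_metric_dist_null strict_mono_Suc_iff)
qed

section \<open>Metrizability of the forward topology\<close>

locale forward_backward_quasi_metric_space = quasi_metric_space +
  assumes forward_imp_backward: "forward_imp_backward X d"
begin

sublocale sym: Metric_space X "symmetrization d"
  by (rule Metric_space_symmetrization)

text \<open>Otherwise points of ever smaller forward balls stay outside the symmetric ball. They
  converge forward to \<open>x\<close>, hence also backward, so their symmetrized distance to
  \<open>x\<close> tends to 0.\<close>

lemma forward_ball_subset_mball:
  assumes x: "x \<in> X" and "0 < e"
  obtains r where "0 < r" "forward_ball X d x r \<subseteq> sym.mball x e"
proof -
  have "\<exists>r>0. forward_ball X d x r \<subseteq> sym.mball x e"
  proof (rule ccontr)
    assume "\<not> ?thesis"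
    then have "\<exists>y. y \<in> X \<and> d x y < inverse (Suc n) \<and> y \<notin> sym.mball x e" for n
      by (force simp: forward_ball_def subset_iff simp del: sym.in_mball)
    then obtain s where s: "\<And>n. s n \<in> X" "\<And>n. d x (s n) < inverse (Suc n)"
        "\<And>n. s n \<notin> sym.mball x e"
      by metis
    have fwd: "(\<lambda>n. d x (s n)) \<longlonglongrightarrow> 0"
      using s x
      by (intro tendsto_sandwich[OF _ _ tendsto_const LIMSEQ_inverse_real_of_nat])
         (auto intro!: always_eventually less_imp_le simp: nonneg)
    then have "(\<lambda>n. d (s n) x) \<longlonglongrightarrow> 0"
      using forward_imp_backward s x
      unfolding forward_imp_backward_def forward_convergent_def backward_convergent_def by blast
    from tendsto_add[OF fwd this] have "(\<lambda>n. symmetrization d x (s n)) \<longlonglongrightarrow> 0"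
      using s x by (simp add: symmetrization_def nonneg)
    then have "\<forall>\<^sub>F n in sequentially. symmetrization d x (s n) < e"
      using \<open>0 < e\<close> by (rule order_tendstoD)
    then show False
      using s x by (auto simp: eventually_sequentially)
  qed
  with that show thesis by blast
qed

lemma forward_topology_eq_mtopology: "forward_topology X d = sym.mtopology"
proof (rule topology_eq[THEN iffD2], intro allI iffI)
  fix U assume "openin (forward_topology X d) U"
  then have U: "generate_topology_on {forward_ball X d x \<epsilon> |x \<epsilon>. x \<in> X \<and> 0 < \<epsilon>} U"
    by (simp add: forward_topology_def openin_topology_generated_by_iff)
  have "openin sym.mtopology S" if "S \<in> {forward_ball X d x \<epsilon> |x \<epsilon>. x \<in> X \<and> 0 < \<epsilon>}" for S
  proof -
    obtain x \<epsilon> where S: "S = forward_ball X d x \<epsilon>" "x \<in> X"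
      using \<open>S \<in> _\<close> by blast
    \<comment> \<open>Since \<open>symmetrization d\<close> dominates \<open>d\<close>, the usual
      radius \<epsilon> - \<open>d x y\<close> works.\<close>
    have "\<exists>r>0. sym.mball y r \<subseteq> S" if "y \<in> S" for y
    proof (intro exI conjI)
      show "0 < \<epsilon> - d x y"
        using that S by (simp add: forward_ball_def)
      show "sym.mball y (\<epsilon> - d x y) \<subseteq> S"
        using that S triangle[of x _ y] by (force simp: forward_ball_def symmetrization_def)
    qed
    moreover have "S \<subseteq> X"
      using S by (auto simp: forward_ball_def)
    ultimately show ?thesis
      by (simp add: sym.openin_mtopology)
  qed
  from generate_topology_on_coarsest[OF istopology_openin this U]
  show "openin sym.mtopology U" .
next
  fix U assume U: "openin sym.mtopology U"
  have "\<exists>V. openin (forward_topology X d) V \<and> x \<in> V \<and> V \<subseteq> U" if "x \<in> U" for x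
  proof -
    obtain e where e: "x \<in> X" "0 < e" "sym.mball x e \<subseteq> U"
      using U \<open>x \<in> U\<close> unfolding sym.openin_mtopology by blast
    then obtain r where "0 < r" "forward_ball X d x r \<subseteq> sym.mball x e"
      using forward_ball_subset_mball by blast
    moreover have "openin (forward_topology X d) (forward_ball X d x r)"
      unfolding forward_topology_def using e \<open>0 < r\<close> by (intro topology_generated_by_Basis) blast
    moreover have "x \<in> forward_ball X d x r"
      using e \<open>0 < r\<close> by (simp add: forward_ball_def refl)
    ultimately show ?thesis
      using e by blast
  qed
  then show "openin (forward_topology X d) U"
    by (subst openin_subopen) blast
qed

section \<open>Transfer of limits and extraction of convergent subsequences\<close>

text \<open>The triangle inequality through \<open>a n\<close> controls only the distance from
  \<open>z\<close> to \<open>b n\<close>, as nothing is known about \<open>d (b n) (a n)\<close>.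
  The opposite direction is supplied by \<open>forward_convergent_imp_limitin\<close>.\<close>

lemma limitin_forward_transfer:
  assumes "limitin sym.mtopology a z F" and "\<And>n. b n \<in> X" and "((\<lambda>n. d (a n) (b n)) \<longlongrightarrow> 0) F"
  shows "((\<lambda>n. d z (b n)) \<longlongrightarrow> 0) F"
proof (rule tendsto_sandwich)
  have z: "z \<in> X" and a: "\<forall>\<^sub>F n in F. a n \<in> X"
    and lim: "((\<lambda>n. symmetrization d (a n) z) \<longlongrightarrow> 0) F"
    using assms(1) by (auto simp: sym.limitin_metric_dist_null)
  show "\<forall>\<^sub>F n in F. 0 \<le> d z (b n)"
    using assms(2) z by (simp add: nonneg)
  show "\<forall>\<^sub>F n in F. d z (b n) \<le> symmetrization d (a n) z + d (a n) (b n)"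
    using a
  proof eventually_elim
    case (elim n)
    then show ?case
      using triangle[of z "b n" "a n"] assms(2) z by (simp add: symmetrization_def)
  qed
  show "((\<lambda>n. symmetrization d (a n) z + d (a n) (b n)) \<longlongrightarrow> 0) F"
    using tendsto_add[OF lim assms(3)] by simp
qed auto

lemma forward_convergent_imp_limitin:
  assumes "z \<in> X" and "\<And>n. b n \<in> X" and "(\<lambda>n. d z (b n)) \<longlonglongrightarrow> 0"
  shows "limitin sym.mtopology b z sequentially"
proof -
  have "(\<lambda>n. d (b n) z) \<longlonglongrightarrow> 0"
    using forward_imp_backward assms
    unfolding forward_imp_backward_def forward_convergent_def backward_convergent_def by blast
  from tendsto_add[OF assms(3) this] show ?thesis
    using assms by (simp add: sym.limitin_metric_dist_null symmetrization_def nonneg add.commute)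
qed

lemma convergent_subsequence:
  assumes ud: "\<And>A. \<lbrakk>closedin sym.mtopology A; discrete_subset sym.mtopology A\<rbrakk>
      \<Longrightarrow> uniformly_discrete d A"
    and X: "range a \<subseteq> X" "range b \<subseteq> X"
    and ne: "\<And>n. a n \<noteq> b n" and lim: "(\<lambda>n. d (a n) (b n)) \<longlonglongrightarrow> 0"
  obtains z r where "strict_mono r" "limitin sym.mtopology (a \<circ> r) z sequentially"
proof -
  \<comment> \<open>An empty derived set means closed and discrete at once, a condition stable under
    finite unions.\<close>
  have ud': "uniformly_discrete d A" if "A \<subseteq> X" "sym.mtopology derived_set_of A = {}" for A
    using that subtopology_eq_discrete_topology_gen[of A sym.mtopology]
    by (intro ud) (auto simp: closedin_contains_derived_set discrete_subset_def Int_absorb1)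
  have "\<exists>z r. strict_mono r \<and> limitin sym.mtopology (a \<circ> r) z sequentially"
  proof (cases "sym.mtopology derived_set_of (range a) = {}")
    case False
    then show ?thesis
      using sym.derived_set_of_range_subsequence[OF X(1)] by blast
  next
    case da: True
    show ?thesis
    proof (cases "sym.mtopology derived_set_of (range b) = {}")
      case True
      then have "uniformly_discrete d (range a \<union> range b)"
        using X da by (intro ud') (auto simp: derived_set_of_Un)
      then obtain \<delta> where \<delta>: "\<delta> > 0"
        "\<forall>x\<in>range a \<union> range b. \<forall>y\<in>range a \<union> range b. x \<noteq> y \<longrightarrow> \<delta> \<le> d x y"
        unfolding uniformly_discrete_def by blast
      have "\<forall>\<^sub>F n in sequentially. d (a n) (b n) < \<delta>"
        using lim \<delta>(1) by (rule order_tendstoD)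
      then obtain n where "d (a n) (b n) < \<delta>"
        by (auto simp: eventually_sequentially)
      moreover have "\<delta> \<le> d (a n) (b n)"
        using \<delta>(2) ne[of n] by simp
      ultimately show ?thesis by simp
    next
      \<comment> \<open>Here \<open>b\<close> accumulates at \<open>z\<close>, which by the triangle
        inequality makes only \<open>d (a (r n)) z\<close> small. This is backward convergence, so
        uniform discreteness is applied again, with \<open>z\<close> adjoined to
        \<open>range a\<close>: a small distance to \<open>z\<close> then forces equality with
        \<open>z\<close>.\<close>
      case False
      then obtain z r where r: "strict_mono r" "limitin sym.mtopology (b \<circ> r) z sequentially"
        using sym.derived_set_of_range_subsequence[OF X(2)] by blast
      then have z: "z \<in> X" and limb: "(\<lambda>n. symmetrization d (b (r n)) z) \<longlonglongrightarrow> 0"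
        by (auto simp: sym.limitin_metric_dist_null)
      have "sym.mtopology derived_set_of ({z} \<union> range a) = {}"
        unfolding derived_set_of_Un
        using da sym.Hausdorff_space_mtopology by (simp add: derived_set_of_singleton)
      then have "uniformly_discrete d ({z} \<union> range a)"
        using X z by (intro ud') auto
      then obtain \<delta> where \<delta>: "\<delta> > 0" "\<And>n. a n \<noteq> z \<Longrightarrow> \<delta> \<le> d (a n) z"
        unfolding uniformly_discrete_def by blast
      have "(\<lambda>n. d (a (r n)) (b (r n)) + symmetrization d (b (r n)) z) \<longlonglongrightarrow> 0"
        using tendsto_add[OF LIMSEQ_subseq_LIMSEQ[OF lim r(1)] limb] by (simp add: o_def)
      then have "\<forall>\<^sub>F n in sequentially. d (a (r n)) (b (r n)) + symmetrization d (b (r n)) z < \<delta>"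
        using \<delta>(1) by (rule order_tendstoD)
      then have "\<forall>\<^sub>F n in sequentially. (a \<circ> r) n = z"
      proof eventually_elim
        case (elim n)
        have "d (a (r n)) z \<le> d (a (r n)) (b (r n)) + symmetrization d (b (r n)) z"
          using triangle[of "a (r n)" z "b (r n)"] X z by (force simp: symmetrization_def)
        then show ?case
          using \<delta>(2)[of "r n"] elim by force
      qed
      then have "limitin sym.mtopology (a \<circ> r) z sequentially"
        using z by (intro limitin_eventually) auto
      with r(1) show ?thesis by blast
    qed
  qed
  with that show thesis by blast
qed

section \<open>Gaps between closed sets: from (a) to (b)\<close>

lemma set_gap_greatest:
  assumes "A \<noteq> {}" "B \<noteq> {}" "\<And>a b. \<lbrakk>a \<in> A; b \<in> B\<rbrakk> \<Longrightarrow> \<delta> \<le> d a b"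
  shows "\<delta> \<le> set_gap d A B"
  unfolding set_gap_def using assms by (intro cInf_greatest) auto

lemma set_gap_lower:
  assumes "A \<subseteq> X" "B \<subseteq> X" "a \<in> A" "b \<in> B"
  shows "set_gap d A B \<le> d a b"
  unfolding set_gap_def using assms
  by (intro cInf_lower bdd_belowI[of _ 0]) (auto intro!: nonneg)

lemma UC_space_imp_gap_pos:
  assumes "UC_space X d" "closedin sym.mtopology A" "closedin sym.mtopology B"
    and "A \<noteq> {}" "B \<noteq> {}" "A \<inter> B = {}"
  shows "set_gap d A B > 0"
proof -
  obtain f where f: "continuous_map sym.mtopology euclideanreal f" "f ` A \<subseteq> {0}" "f ` B \<subseteq> {1}"
    using Urysohn_lemma_alt[OF sym.normal_space_mtopology assms(2,3)] assms(6)
    by (metis disjnt_def)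
  then have "quasi_uniformly_continuous X d f"
    using assms(1) by (auto simp: UC_space_def forward_continuous_def forward_topology_eq_mtopology)
  \<comment> \<open>The tolerance 1 is exactly the difference between the values of \<open>f\<close>
    on \<open>A\<close> and on \<open>B\<close>.\<close>
  then obtain \<delta> where \<delta>: "\<delta> > 0" "\<And>x y. \<lbrakk>x \<in> X; y \<in> X; d x y < \<delta>\<rbrakk> \<Longrightarrow> \<bar>f x - f y\<bar> < 1"
    unfolding quasi_uniformly_continuous_def by (metis zero_less_one)
  have "A \<subseteq> X" "B \<subseteq> X"
    using assms(2,3) closedin_subset by fastforce+
  have "\<delta> \<le> d a b" if "a \<in> A" "b \<in> B" for a b
  proof (rule ccontr)
    assume "\<not> \<delta> \<le> d a b"
    moreover have "f a = 0" "f b = 1" using f that by auto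
    ultimately show False
      using \<delta>(2)[of a b] that \<open>A \<subseteq> X\<close> \<open>B \<subseteq> X\<close> by auto
  qed
  then have "\<delta> \<le> set_gap d A B"
    using assms by (intro set_gap_greatest)
  with \<delta> show ?thesis by simp
qed

section \<open>Separating pairs in a closed discrete set: from (b) to (c)\<close>

lemma gap_pos_imp_uniformly_discrete:
  assumes gap: "\<And>A B. \<lbrakk>closedin sym.mtopology A; closedin sym.mtopology B;
      A \<noteq> {}; B \<noteq> {}; A \<inter> B = {}\<rbrakk> \<Longrightarrow> set_gap d A B > 0"
    and A: "closedin sym.mtopology A" "discrete_subset sym.mtopology A"
  shows "uniformly_discrete d A"
proof (rule ccontr)
  assume not_ud: "\<not> uniformly_discrete d A"
  have AX: "A \<subseteq> X"
    using closedin_subset[OF A(1)] by simp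
  have closed: "closedin sym.mtopology B" if "B \<subseteq> A" for B
  proof (rule closedin_trans_full[OF _ A(1)])
    have "subtopology sym.mtopology A = discrete_topology A"
      using A(2) by (simp add: discrete_subset_def)
    then show "closedin (subtopology sym.mtopology A) B"
      using that by simp
  qed
  have gap': "\<exists>\<delta>>0. \<forall>x\<in>B. \<forall>y\<in>C. \<delta> \<le> d x y" if "B \<subseteq> A" "C \<subseteq> A" "B \<inter> C = {}" for B C
  proof (cases "B = {} \<or> C = {}")
    case True
    then show ?thesis by (auto intro: exI[of _ 1])
  next
    case False
    then show ?thesis
      using gap[of B C] closed[of B] closed[of C] that set_gap_lower[of B C] AX
      by (intro exI[of _ "set_gap d B C"]) auto
  qed
  \<comment> \<open>The gap between \<open>{z}\<close> and its complement in \<open>A\<close> is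
    taken in both orders, because \<open>d\<close> need not be symmetric.\<close>
  have isolated: "\<exists>\<delta>>0. \<forall>y\<in>A. y \<noteq> z \<longrightarrow> \<delta> \<le> d z y \<and> \<delta> \<le> d y z" if "z \<in> A" for z
  proof -
    obtain \<delta> \<delta>' where "\<delta> > 0" "\<forall>y\<in>A - {z}. \<delta> \<le> d z y" "\<delta>' > 0" "\<forall>y\<in>A - {z}. \<delta>' \<le> d y z"
      using gap'[of "{z}" "A - {z}"] gap'[of "A - {z}" "{z}"] \<open>z \<in> A\<close> by auto
    then show ?thesis
      by (intro exI[of _ "min \<delta> \<delta>'"]) (auto simp: min_le_iff_disj)
  qed
  have isolated_finite: "\<exists>\<delta>>0. \<forall>z\<in>F. \<forall>y\<in>A. y \<noteq> z \<longrightarrow> \<delta> \<le> d z y \<and> \<delta> \<le> d y z"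
    if "finite F" "F \<subseteq> A" for F
    using that
  proof (induction F)
    case empty
    then show ?case by (auto intro: exI[of _ 1])
  next
    case (insert z F)
    then obtain \<delta> \<delta>' where "\<delta> > 0" "\<forall>z\<in>F. \<forall>y\<in>A. y \<noteq> z \<longrightarrow> \<delta> \<le> d z y \<and> \<delta> \<le> d y z"
      "\<delta>' > 0" "\<forall>y\<in>A. y \<noteq> z \<longrightarrow> \<delta>' \<le> d z y \<and> \<delta>' \<le> d y z"
      using isolated[of z] by auto
    then show ?case
      by (intro exI[of _ "min \<delta> \<delta>'"]) (auto simp: min_le_iff_disj)
  qed
  \<comment> \<open>A pair of distinct points closer than the isolation bound \<delta> of
    \<open>F\<close> cannot have either member in \<open>F\<close>.\<close>
  have step: "\<exists>x\<in>A - F. \<exists>y\<in>A - F. x \<noteq> y \<and> d x y < e" if F: "finite F" "F \<subseteq> A" and "e > 0" for F e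
  proof -
    obtain \<delta> where \<delta>: "\<delta> > 0" "\<forall>z\<in>F. \<forall>y\<in>A. y \<noteq> z \<longrightarrow> \<delta> \<le> d z y \<and> \<delta> \<le> d y z"
      using isolated_finite[OF F] by blast
    obtain x y where "x \<in> A" "y \<in> A" "x \<noteq> y" "d x y < min \<delta> e"
      using not_ud \<open>\<delta> > 0\<close> \<open>e > 0\<close> unfolding uniformly_discrete_def
      by (metis min_less_iff_conj not_less)
    then show ?thesis
      using \<delta>(2) by fastforce
  qed
  \<comment> \<open>The state carries the finite set \<open>F\<close> of all points used so far, so
    that each new pair can avoid every earlier one.\<close>
  define P where "P n = (\<lambda>(F, x, y). finite F \<and> F \<subseteq> A \<and> x \<in> A - F \<and> y \<in> A - F \<and> x \<noteq> y \<and>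
      d x y < inverse (real (Suc n)))" for n
  have "\<exists>p. \<forall>n. P n (p n) \<and>
      (case (p n, p (Suc n)) of ((F, x, y), (F', _)) \<Rightarrow> F' = insert x (insert y F))"
  proof (rule dependent_nat_choice)
    show "\<exists>p. P 0 p"
      using step[of "{}" 1] by (auto simp: P_def)
    fix p n assume "P n p"
    moreover obtain F x y where p: "p = (F, x, y)" by (metis prod_cases3)
    ultimately obtain x' y' where "P (Suc n) (insert x (insert y F), x', y')"
      using step[of "insert x (insert y F)" "inverse (real (Suc (Suc n)))"]
      unfolding P_def by auto
    with p show "\<exists>q. P (Suc n) q \<and>
        (case (p, q) of ((F, x, y), (F', _)) \<Rightarrow> F' = insert x (insert y F))"
      by auto
  qed
  then obtain p where p: "\<forall>n. P n (p n) \<and>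
      (case (p n, p (Suc n)) of ((F, x, y), (F', _)) \<Rightarrow> F' = insert x (insert y F))" ..
  define F x y where "F n = fst (p n)" and "x n = fst (snd (p n))" and "y n = snd (snd (p n))" for n
  have xy: "x n \<in> A - F n" "y n \<in> A - F n" "x n \<noteq> y n" "d (x n) (y n) < inverse (real (Suc n))"
    and F_Suc: "F (Suc n) = insert (x n) (insert (y n) (F n))" for n
    using p[rule_format, of n]
    by (simp_all add: P_def F_def x_def y_def case_prod_unfold del: of_nat_Suc)
  have in_F: "x m \<in> F n" "y m \<in> F n" if "m < n" for m n
  proof -
    have "F (Suc m) \<subseteq> F n"
    proof (rule lift_Suc_mono_le)
      show "F k \<subseteq> F (Suc k)" for k by (auto simp: F_Suc)
      show "Suc m \<le> n" using that by simp
    qed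
    then show "x m \<in> F n" "y m \<in> F n"
      by (simp_all add: F_Suc[of m])
  qed
  \<comment> \<open>For distinct indices, the point with the smaller index lies in the
    \<open>F\<close> of the larger index, which the other point avoids.\<close>
  have "x m \<noteq> y n" for m n
    using xy[of m] xy[of n] in_F[of m n] in_F[of n m] by (cases m n rule: linorder_cases) auto
  then have "range x \<inter> range y = {}"
    by auto
  moreover have "range x \<subseteq> A" "range y \<subseteq> A"
    using xy(1,2) by auto
  ultimately obtain \<delta> where \<delta>: "\<delta> > 0" "\<And>n. \<delta> \<le> d (x n) (y n)"
    using gap'[of "range x" "range y"] by blast
  obtain n where "inverse (real (Suc n)) < \<delta>"
    using reals_Archimedean \<delta>(1) by blast
  with \<delta>(2)[of n] xy(4)[of n] show False by linarith
qed

section \<open>Uniform continuity: from (c) to (a)\<close>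

lemma uniformly_discrete_imp_UC_space:
  assumes ud: "\<And>A. \<lbrakk>closedin sym.mtopology A; discrete_subset sym.mtopology A\<rbrakk>
      \<Longrightarrow> uniformly_discrete d A"
  shows "UC_space X d"
  unfolding UC_space_def
proof (intro allI impI)
  fix f assume "forward_continuous X d f"
  then have f: "continuous_map sym.mtopology euclideanreal f"
    by (simp add: forward_continuous_def forward_topology_eq_mtopology)
  show "quasi_uniformly_continuous X d f"
  proof (rule ccontr)
    assume "\<not> ?thesis"
    then obtain \<epsilon> where \<epsilon>: "\<epsilon> > 0"
      and "\<forall>\<delta>>0. \<exists>x\<in>X. \<exists>y\<in>X. d x y < \<delta> \<and> \<epsilon> \<le> \<bar>f x - f y\<bar>"
      unfolding quasi_uniformly_continuous_def by (metis not_less)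
    then have "\<exists>x y. x \<in> X \<and> y \<in> X \<and> d x y < inverse (Suc n) \<and> \<epsilon> \<le> \<bar>f x - f y\<bar>" for n
      by (meson inverse_positive_iff_positive of_nat_0_less_iff zero_less_Suc)
    then obtain a b where ab: "\<And>n. a n \<in> X" "\<And>n. b n \<in> X" "\<And>n. d (a n) (b n) < inverse (Suc n)"
        "\<And>n. \<epsilon> \<le> \<bar>f (a n) - f (b n)\<bar>"
      by metis
    have lim: "(\<lambda>n. d (a n) (b n)) \<longlonglongrightarrow> 0"
      using ab
      by (intro tendsto_sandwich[OF _ _ tendsto_const LIMSEQ_inverse_real_of_nat])
         (auto intro!: always_eventually less_imp_le simp: nonneg simp del: of_nat_Suc)
    have ne: "a n \<noteq> b n" for n
      using ab(4)[of n] \<epsilon> by auto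
    have ranges: "range a \<subseteq> X" "range b \<subseteq> X"
      using ab(1,2) by auto
    obtain z r where r: "strict_mono r" and az: "limitin sym.mtopology (a \<circ> r) z sequentially"
      by (rule convergent_subsequence[OF ud ranges ne lim])
    have "(\<lambda>n. d ((a \<circ> r) n) ((b \<circ> r) n)) \<longlonglongrightarrow> 0"
      using LIMSEQ_subseq_LIMSEQ[OF lim r] by (simp add: o_def)
    \<comment> \<open>The limit \<open>z\<close> of \<open>a \<circ> r\<close> passes to
      \<open>b \<circ> r\<close> first in the forward sense, then for the symmetrized metric, where
      continuity of \<open>f\<close> applies.\<close>
    then have "(\<lambda>n. d z ((b \<circ> r) n)) \<longlonglongrightarrow> 0"
      using limitin_forward_transfer[OF az] ab by simp
    then have "limitin sym.mtopology (b \<circ> r) z sequentially"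
      using forward_convergent_imp_limitin[of z "b \<circ> r"] ab sym.limitin_mspace[OF az] by simp
    from continuous_map_limit[OF f this] have fb: "(\<lambda>n. f (b (r n))) \<longlonglongrightarrow> f z"
      by (simp add: o_def)
    have "(\<lambda>n. f (a (r n))) \<longlonglongrightarrow> f z"
      using continuous_map_limit[OF f az] by (simp add: o_def)
    from tendsto_rabs[OF tendsto_diff[OF this fb]]
    have "(\<lambda>n. \<bar>f (a (r n)) - f (b (r n))\<bar>) \<longlonglongrightarrow> 0"
      by simp
    then have "\<forall>\<^sub>F n in sequentially. \<bar>f (a (r n)) - f (b (r n))\<bar> < \<epsilon>"
      using \<epsilon> by (rule order_tendstoD)
    then obtain n where "\<bar>f (a (r n)) - f (b (r n))\<bar> < \<epsilon>"
      by (auto simp: eventually_sequentially)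
    then show False
      using ab(4)[of "r n"] by simp
  qed
qed

end

theorem theorem4p7:
  fixes X :: "'a set" and d :: "'a \<Rightarrow> 'a \<Rightarrow> real"
  assumes "quasi_metric_space X d"
    and "t1_space (forward_topology X d)"
    and "forward_imp_backward X d"
  shows "(UC_space X d \<longleftrightarrow>
           (\<forall>A B. closedin (forward_topology X d) A \<and> closedin (forward_topology X d) B \<and>
                  A \<noteq> {} \<and> B \<noteq> {} \<and> A \<inter> B = {} \<longrightarrow> set_gap d A B > 0)) \<and>
         ((\<forall>A B. closedin (forward_topology X d) A \<and> closedin (forward_topology X d) B \<and>
                  A \<noteq> {} \<and> B \<noteq> {} \<and> A \<inter> B = {} \<longrightarrow> set_gap d A B > 0) \<longleftrightarrow>
           (\<forall>A. closedin (forward_topology X d) A \<and> discrete_subset (forward_topology X d) A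
                  \<longrightarrow> uniformly_discrete d A))"
proof -
  interpret forward_backward_quasi_metric_space X d
    using assms(1,3)
    by (simp add: forward_backward_quasi_metric_space_def
        forward_backward_quasi_metric_space_axioms_def)
  show ?thesis
    \<comment> \<open>With both topologies identified, the three implications form a cycle, which
      yields both equivalences.\<close>
    unfolding forward_topology_eq_mtopology
    using UC_space_imp_gap_pos gap_pos_imp_uniformly_discrete uniformly_discrete_imp_UC_space
    by metis
qed

end
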